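(* Suppose $p,q,r,s\in\mathbf{Z}_{>0}$ and $M=\left[\begin{array}{cc} p&q\\ r&s\end{array}\right]\in\mathrm{PGL}_2(\mathbf{Z})$ (so $ps-qr=\pm1$). Then $$\alpha(M)=\left[\begin{array}{cc} \mathrm{con}\left(\frac{2p+q}{2r+s}\right)-\mathrm{con}\left(\frac{p+q}{r+s}\right) & 2\,\mathrm{con}\left(\frac{p+q}{r+s}\right)-\mathrm{con}\left(\frac{2p+q}{2r+s}\right)\\[2mm] \mathrm{con}\left(\frac{2r+s}{2p+q}\right)-\mathrm{con}\left(\frac{r+s}{p+q}\right) & 2\,\mathrm{con}\left(\frac{r+s}{p+q}\right)-\mathrm{con}\left(\frac{2r+s}{2p+q}\right)\end{array}\right].$$
   Context: The conumerator $\mathrm{con}:\mathbf{Q}_{>0}\to\mathbf{Z}_{>0}$ is the unique function with $\mathrm{con}(1)=1$ satisfying, for all $x\in\mathbf{Q}_{>0}$, $\mathrm{con}(1+x)=\mathrm{con}(x)+\mathrm{con}(1/x)$ and $\mathrm{con}\left(\frac{1}{1+x}\right)=\mathrm{con}(x)$. Square brackets denote the image in $\mathrm{PGL}_2(\mathbf{Z})=\mathrm{GL}_2(\mathbf{Z})/\{\pm I\}$ of a matrix in $\mathrm{GL}_2(\mathbf{Z})$; the class of $\left(\begin{smallmatrix}a&b\\c&d\end{smallmatrix}\right)$ is identified with the Möbius transformation $x\mapsto\frac{ax+b}{cx+d}$. The group $\mathrm{PGL}_2(\mathbf{Z})$ is generated by $V:x\mapsto -x$, $K:x\mapsto 1-x$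 and $U:x\mapsto 1/x$. The map $\alpha$ is Dyer's (involutive) outer automorphism of $\mathrm{PGL}_2(\mathbf{Z})$, the automorphism determined by $\alpha(V)=UV$ (i.e. $x\mapsto -1/x$), $\alpha(K)=K$, $\alpha(U)=U$. *)

theory Defs
  imports "HOL-Analysis.Determinants" "HOL-Algebra.Coset"
begin

section \<open>The conumerator\<close>

text \<open>
  Functions on the positive rationals are modelled as members of the extensional function
  space, so that the value at a nonpositive rational is \<^const>\<open>undefined\<close> and uniqueness makes
  sense.
\<close>

definition is_conumerator :: "(rat \<Rightarrow> int) \<Rightarrow> bool" where
  "is_conumerator f \<longleftrightarrow>
     f \<in> {0<..} \<rightarrow>\<^sub>E {0<..} \<and>
     f 1 = 1 \<and>
     (\<forall>x>0. f (1 + x) = f x + f (1 / x)) \<and>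
     (\<forall>x>0. f (1 / (1 + x)) = f x)"

definition con :: "rat \<Rightarrow> int" where
  "con = (THE f. is_conumerator f)"

function con_aux :: "nat \<Rightarrow> nat \<Rightarrow> int" where
  "con_aux a b =
     (if a = 0 \<or> b = 0 \<or> a = b then 1
      else if b < a then con_aux (a - b) b + con_aux b (a - b)
      else con_aux (b - a) a)"
  by pat_completeness auto
termination by (relation "measure (\<lambda>(a, b). a + b)") auto

declare con_aux.simps [simp del]

lemma con_aux_pos: "con_aux a b > 0"
proof (induction a b rule: con_aux.induct)
  case (1 a b)
  then show ?case by (subst con_aux.simps) force
qed

lemma pos_rat_cases:
  assumes "(x::rat) > 0"
  obtains a b where "x = of_nat a / of_nat b" "a > 0" "b > 0" "coprime a b"
proof -
  obtain n d where nd: "quotient_of x = (n, d)" by force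
  have d: "d > 0" by (rule quotient_of_denom_pos [OF nd])
  have x: "x = of_int n / of_int d" by (rule quotient_of_div [OF nd])
  have n: "n > 0" using assms d x by (simp add: zero_less_divide_iff)
  have c: "coprime n d" by (rule quotient_of_coprime [OF nd])
  show ?thesis
  proof (rule that [of "nat n" "nat d"])
    show "x = of_nat (nat n) / of_nat (nat d)" using x n d by (simp add: of_nat_nat)
    show "coprime (nat n) (nat d)"
      using c n d by (simp add: coprime_int_iff [symmetric])
  qed (use n d in auto)
qed

lemma quotient_of_nat_divide:
  assumes "a > 0" "b > 0" "coprime a b"
  shows "quotient_of (of_nat a / of_nat b) = (int a, int b)"
proof -
  have "(of_nat a / of_nat b :: rat) = Fract (int a) (int b)"
    by (simp add: Fract_of_int_quotient)
  then show ?thesis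
    using assms by (simp add: quotient_of_Fract normalize_def)
qed

lemma is_conumerator_unique:
  assumes f: "is_conumerator f" and g: "is_conumerator g"
  shows "f = g"
proof -
  have main: "f (of_nat a / of_nat b) = g (of_nat a / of_nat b)" if "a > 0" "b > 0" for a b :: nat
    using that
  proof (induction "a + b" arbitrary: a b rule: less_induct)
    case less
    consider "a = b" | "b < a" | "a < b" by linarith
    then show ?case
    proof cases
      case 1
      then show ?thesis using less.prems f g by (simp add: is_conumerator_def)
    next
      case 2
      define x :: rat where "x = of_nat (a - b) / of_nat b"
      have x: "x > 0" using 2 less.prems by (simp add: x_def)
      have e: "of_nat a / of_nat b = 1 + x"
        using 2 less.prems by (simp add: x_def of_nat_diff field_simps)
      have "f x = g x" unfolding x_def using 2 less.prems by (intro less.hyps) auto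
      moreover have "f (1 / x) = g (1 / x)"
        using less.hyps [of b "a - b"] 2 less.prems by (simp add: x_def)
      ultimately show ?thesis using f g x unfolding e is_conumerator_def by simp
    next
      case 3
      define x :: rat where "x = of_nat (b - a) / of_nat a"
      have x: "x > 0" using 3 less.prems by (simp add: x_def)
      have e: "of_nat a / of_nat b = 1 / (1 + x)"
        using 3 less.prems by (simp add: x_def of_nat_diff field_simps)
      have "f x = g x" unfolding x_def using 3 less.prems by (intro less.hyps) auto
      then show ?thesis using f g x unfolding e is_conumerator_def by simp
    qed
  qed
  show ?thesis
  proof (rule PiE_ext)
    show "f \<in> {0<..} \<rightarrow>\<^sub>E {0<..}" "g \<in> {0<..} \<rightarrow>\<^sub>E {0<..}"
      using f g by (auto simp only: is_conumerator_def)
    fix x :: rat assume "x \<in> {0<..}"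
    then show "f x = g x" using main by (metis greaterThan_iff pos_rat_cases)
  qed
qed

lemma is_conumerator_exists: "\<exists>f. is_conumerator f"
proof -
  define f :: "rat \<Rightarrow> int" where
    "f = (\<lambda>x\<in>{0<..}. con_aux (nat (fst (quotient_of x))) (nat (snd (quotient_of x))))"
  have fq: "f (of_nat a / of_nat b) = con_aux a b" if "a > 0" "b > 0" "coprime a b" for a b
    using that by (simp add: f_def quotient_of_nat_divide)
  have "is_conumerator f"
    unfolding is_conumerator_def
  proof (intro conjI allI impI)
    show "f \<in> {0<..} \<rightarrow>\<^sub>E {0<..}" by (auto simp: f_def con_aux_pos)
    show "f 1 = 1" using fq [of 1 1] by (simp add: con_aux.simps)
  next
    fix x :: rat assume "x > 0"
    then obtain a b where x: "x = of_nat a / of_nat b" and ab: "a > 0" "b > 0" "coprime a b"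
      by (rule pos_rat_cases)
    have 1: "1 + x = of_nat (a + b) / of_nat b" using ab by (simp add: x field_simps)
    have 2: "1 / x = of_nat b / of_nat a" by (simp add: x)
    have 3: "1 / (1 + x) = of_nat b / of_nat (a + b)" unfolding 1 by simp
    have c1: "coprime (a + b) b" using ab by (simp add: coprime_iff_gcd_eq_1)
    then have c: "coprime (a + b) b" "coprime b (a + b)" "coprime b a"
      using ab by (simp_all only: coprime_commute [of b])
    have "f (1 + x) = con_aux (a + b) b" unfolding 1 using ab c by (intro fq) auto
    also have "\<dots> = con_aux a b + con_aux b a" using ab by (subst con_aux.simps) auto
    also have "con_aux a b = f x" unfolding x using ab by (intro fq [symmetric])
    also have "con_aux b a = f (1 / x)" unfolding 2 using ab c by (intro fq [symmetric])
    finally show "f (1 + x) = f x + f (1 / x)" .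
    have "f (1 / (1 + x)) = con_aux b (a + b)" unfolding 3 using ab c by (intro fq) auto
    also have "\<dots> = con_aux a b" using ab by (subst con_aux.simps) auto
    also have "\<dots> = f x" unfolding x using ab by (intro fq [symmetric])
    finally show "f (1 / (1 + x)) = f x" .
  qed
  then show ?thesis by blast
qed

lemma is_conumerator_con: "is_conumerator con"
proof -
  have "\<exists>!f. is_conumerator f"
    using is_conumerator_exists is_conumerator_unique by blast
  then show ?thesis unfolding con_def by (rule theI')
qed

lemma con_pos: "x > 0 \<Longrightarrow> con x > 0"
  using is_conumerator_con by (auto simp: is_conumerator_def PiE_def Pi_def)

lemma con_1 [simp]: "con 1 = 1"
  using is_conumerator_con by (simp add: is_conumerator_def)

lemma con_1_plus: "x > 0 \<Longrightarrow> con (1 + x) = con x + con (1 / x)"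
  using is_conumerator_con by (simp add: is_conumerator_def)

lemma con_inverse_1_plus: "x > 0 \<Longrightarrow> con (1 / (1 + x)) = con x"
  using is_conumerator_con by (simp add: is_conumerator_def)


section \<open>The group \<open>PGL\<^sub>2(\<int>)\<close>\<close>

definition mat2 :: "int \<Rightarrow> int \<Rightarrow> int \<Rightarrow> int \<Rightarrow> int^2^2" where
  "mat2 a b c d = vector [vector [a, b], vector [c, d]]"

definition GL2Z :: "(int^2^2) monoid" where
  "GL2Z = \<lparr>carrier = {A. invertible A}, mult = (**), one = mat 1\<rparr>"

definition PGL2Z :: "(int^2^2) set monoid" where
  "PGL2Z = GL2Z Mod {mat 1, - mat 1}"

definition pgl :: "int \<Rightarrow> int \<Rightarrow> int \<Rightarrow> int \<Rightarrow> (int^2^2) set" where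
  "pgl a b c d = {mat 1, - mat 1} #>\<^bsub>GL2Z\<^esub> mat2 a b c d"

lemma mat2_nth [simp]:
  "mat2 a b c d $ 1 $ 1 = a" "mat2 a b c d $ 1 $ 2 = b"
  "mat2 a b c d $ 2 $ 1 = c" "mat2 a b c d $ 2 $ 2 = d"
  by (simp_all add: mat2_def)

lemma mat2_eq_iff:
  "A = B \<longleftrightarrow> A $ 1 $ 1 = B $ 1 $ 1 \<and> A $ 1 $ 2 = B $ 1 $ 2 \<and> A $ 2 $ 1 = B $ 2 $ 1 \<and> A $ 2 $ 2 = B $ 2 $ 2"
  for A B :: "int^2^2"
  by (auto simp: vec_eq_iff forall_2)

lemma mat2_mult:
  "mat2 a b c d ** mat2 a' b' c' d' =
   mat2 (a * a' + b * c') (a * b' + b * d') (c * a' + d * c') (c * b' + d * d')"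
  by (simp add: mat2_eq_iff matrix_matrix_mult_def sum_2)

lemma uminus_mat2: "- mat2 a b c d = mat2 (- a) (- b) (- c) (- d)"
  by (simp add: mat2_eq_iff)

lemma uminus_mult: "(- A) ** B = - (A ** B)" "B ** (- A) = - (B ** A)" for A B :: "int^2^2"
  by (simp_all add: mat2_eq_iff matrix_matrix_mult_def sum_2)

lemma invertible_mat2_iff: "invertible (mat2 a b c d) \<longleftrightarrow> a * d - b * c \<in> {1, -1}"
proof
  assume "invertible (mat2 a b c d)"
  then obtain B where "mat2 a b c d ** B = mat 1" by (auto simp: invertible_def)
  then have "det (mat2 a b c d) * det B = 1" by (metis det_I det_mul)
  then have "det (mat2 a b c d) dvd 1" by (metis dvd_triv_left)
  then show "a * d - b * c \<in> {1, -1}" by (auto simp: det_2)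
next
  assume D: "a * d - b * c \<in> {1, -1}"
  define e where "e = a * d - b * c"
  have e: "e * e = 1" using D by (auto simp: e_def)
  have "mat2 a b c d ** mat2 (e * d) (- e * b) (- e * c) (e * a) = mat 1"
    "mat2 (e * d) (- e * b) (- e * c) (e * a) ** mat2 a b c d = mat 1"
    using e by (simp_all add: mat2_mult mat2_eq_iff mat_def e_def algebra_simps)
  then show "invertible (mat2 a b c d)" by (auto simp: invertible_def)
qed

lemma invertible_mat_1: "invertible (mat 1 :: int^2^2)"
  unfolding invertible_def by (rule exI [of _ "mat 1"]) simp

lemma group_GL2Z: "group GL2Z"
proof (rule groupI)
  fix x assume "x \<in> carrier GL2Z"
  then show "\<exists>y\<in>carrier GL2Z. y \<otimes>\<^bsub>GL2Z\<^esub> x = \<one>\<^bsub>GL2Z\<^esub>"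
    by (auto simp: GL2Z_def invertible_def)
qed (auto simp: GL2Z_def invertible_mult matrix_mul_assoc invertible_mat_1)

lemma normal_center_GL2Z: "{mat 1, - mat 1} \<lhd> GL2Z"
proof -
  interpret group GL2Z by (rule group_GL2Z)
  have inv: "invertible (- mat 1 :: int^2^2)"
    unfolding invertible_def by (rule exI [of _ "- mat 1"]) (simp add: uminus_mult)
  have *: "inv\<^bsub>GL2Z\<^esub> (- mat 1) = - mat 1"
    by (rule inv_equality) (use inv in \<open>simp_all add: GL2Z_def uminus_mult\<close>)
  have "subgroup {mat 1, - mat 1} GL2Z"
  proof (rule subgroupI)
    fix a assume "a \<in> {mat 1, - mat 1 :: int^2^2}"
    moreover have "inv\<^bsub>GL2Z\<^esub> (mat 1) = mat 1" using inv_one by (simp add: GL2Z_def)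
    ultimately show "inv\<^bsub>GL2Z\<^esub> a \<in> {mat 1, - mat 1}" using * by auto
  qed (use inv in \<open>auto simp: GL2Z_def uminus_mult invertible_mat_1\<close>)
  then show ?thesis
    by (rule normalI) (auto simp: r_coset_def l_coset_def GL2Z_def uminus_mult)
qed

lemma group_PGL2Z: "group PGL2Z"
  unfolding PGL2Z_def by (rule normal.factorgroup_is_group [OF normal_center_GL2Z])

lemma pgl_eq: "pgl a b c d = {mat2 a b c d, - mat2 a b c d}"
  by (auto simp: pgl_def r_coset_def GL2Z_def uminus_mult)

lemma pgl_in_PGL2Z_iff: "pgl a b c d \<in> carrier PGL2Z \<longleftrightarrow> a * d - b * c \<in> {1, -1}"
proof -
  have "pgl a b c d \<in> carrier PGL2Z \<longleftrightarrow> invertible (mat2 a b c d)"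
  proof
    assume "pgl a b c d \<in> carrier PGL2Z"
    then obtain A :: "int^2^2" where A: "invertible A" "{mat2 a b c d, - mat2 a b c d} = {A, - A}"
      unfolding pgl_eq by (auto simp: PGL2Z_def FactGroup_def RCOSETS_def r_coset_def GL2Z_def uminus_mult)
    then have "mat2 a b c d = A \<or> mat2 a b c d = - A" by blast
    moreover have "invertible (- A)"
      using A(1) unfolding invertible_def by (metis minus_minus uminus_mult)
    ultimately show "invertible (mat2 a b c d)" using A(1) by auto
  next
    assume "invertible (mat2 a b c d)"
    then show "pgl a b c d \<in> carrier PGL2Z"
      by (auto simp: pgl_def PGL2Z_def FactGroup_def RCOSETS_def GL2Z_def)
  qed
  then show ?thesis by (simp only: invertible_mat2_iff)
qed


section \<open>Dyer's automorphism\<close>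

text \<open>As Moebius transformations: \<open>V: x \<mapsto> - x\<close>, \<open>K: x \<mapsto> 1 - x\<close>, \<open>U: x \<mapsto> 1 / x\<close>.\<close>

definition pgl_V :: "(int^2^2) set" where "pgl_V = pgl (-1) 0 0 1"
definition pgl_K :: "(int^2^2) set" where "pgl_K = pgl (-1) 1 0 1"
definition pgl_U :: "(int^2^2) set" where "pgl_U = pgl 0 1 1 0"

text \<open>
  Since \<open>V\<close>, \<open>K\<close> and \<open>U\<close> generate the group, the following determines the values of
  \<open>\<alpha>\<close> on the carrier; values elsewhere are left unconstrained.
\<close>

definition is_Dyer_automorphism :: "((int^2^2) set \<Rightarrow> (int^2^2) set) \<Rightarrow> bool" where
  "is_Dyer_automorphism \<alpha> \<longleftrightarrow>
     \<alpha> \<in> iso PGL2Z PGL2Z \<and>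
     \<alpha> pgl_V = pgl_U \<otimes>\<^bsub>PGL2Z\<^esub> pgl_V \<and>
     \<alpha> pgl_K = pgl_K \<and>
     \<alpha> pgl_U = pgl_U"

end

theory Submission
  imports Defs
begin

text \<open>
  The formula comes from comparing two left actions of the generators \<open>T: x \<mapsto> 1 + x\<close> and
  \<open>U: x \<mapsto> 1 / x\<close>. With \<open>y = M 1\<close> and \<open>z = M 2\<close>, the columns of the claimed matrix are the
  combinations \<open>f z - f y\<close> and \<open>2 f y - f z\<close> of the vectors \<open>f x = (con x, con (1 / x))\<close>. The functional
  equations of \<open>con\<close> say that \<open>f (1 + x) = \<alpha> T (f x)\<close> and \<open>f (1 / x) = \<alpha> U (f x)\<close>, where
  \<open>\<alpha> T = \<alpha> (K V) = K U V\<close> is \<open>x \<mapsto> 1 + 1 / x\<close>. So both sides transform alike under \<open>T\<close> and \<open>U\<close>;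
  they agree at the identity, and by Euclid's algorithm on the rows \<open>T\<close> and \<open>U\<close> generate all
  unimodular matrices with nonnegative entries.
\<close>

text \<open>Induction on the sum of the entries. If one row dominates the other entrywise,
  subtracting it lowers the sum; otherwise the rows cross, which leaves only the identity and its
  row swap.\<close>

lemma nonneg_unimodular_induct [consumes 5, case_names one swap add]:
  fixes p q r s :: int
  assumes "p \<ge> 0" "q \<ge> 0" "r \<ge> 0" "s \<ge> 0" "p * s - q * r \<in> {1, -1}"
    and one: "P 1 0 0 1"
    and swap: "\<And>p q r s. \<lbrakk>p \<ge> 0; q \<ge> 0; r \<ge> 0; s \<ge> 0; p * s - q * r \<in> {1, -1}; P p q r s\<rbrakk>
      \<Longrightarrow> P r s p q"
    and add: "\<And>p q r s. \<lbrakk>p \<ge> 0; q \<ge> 0; r \<ge> 0; s \<ge> 0; p * s - q * r \<in> {1, -1}; P p q r s\<rbrakk>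
      \<Longrightarrow> P (p + r) (q + s) r s"
  shows "P p q r s"
  using assms(1-5)
proof (induction "nat (p + q + r + s)" arbitrary: p q r s rule: less_induct)
  case less
  have dominated: "P (a + c) (b + d) c d"
    if "a \<ge> 0" "b \<ge> 0" "c \<ge> 0" "d \<ge> 0" "a * d - b * c \<in> {1, -1}"
      "a + b + 2 * c + 2 * d = p + q + r + s" for a b c d
  proof (rule add)
    \<comment> \<open>A zero row would give determinant 0, so the sum strictly drops.\<close>
    have "c + d > 0" using that(3-5) by (cases "c = 0"; cases "d = 0") auto
    then show "P a b c d" using that by (intro less.hyps) auto
  qed (use that in auto)
  have diagonal: "a = 1 \<and> b = 0 \<and> c = 0 \<and> d = 1"
    if "a > c" "d > b" "b \<ge> 0" "c \<ge> 0" "a * d - b * c \<in> {1, -1}" for a b c d :: int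
  proof -
    \<comment> \<open>Hence the determinant is at least \<open>b + c + 1\<close>, yet it is at most
      1.\<close>
    have "(c + 1) * (b + 1) \<le> a * d" using that by (intro mult_mono) auto
    then have "b + c \<le> 0" using that(5) by (auto simp: algebra_simps)
    then have bc: "b = 0" "c = 0" using that by auto
    have "a * d > 0" using that by (intro mult_pos_pos) auto
    then have "a * d = 1" using bc that(5) by auto
    then show ?thesis using bc that pos_zmult_eq_1_iff [of a d] by auto
  qed
  consider "r \<le> p" "s \<le> q" | "p \<le> r" "q \<le> s" | "r < p" "q < s" | "p < r" "s < q" by linarith
  then show ?case
  proof cases
    case 1
    then show ?thesis
      using dominated [of "p - r" "q - s" r s] less.prems by (auto simp: algebra_simps)
  next
    case 2
    have "P r s p q"
      using dominated [of "r - p" "s - q" p q] 2 less.prems by (auto simp: algebra_simps)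
    then show ?thesis using less.prems by (intro swap [of r s p q]) (auto simp: algebra_simps)
  next
    case 3
    then show ?thesis using diagonal [where a = p and b = q and c = r and d = s] less.prems one by auto
  next
    case 4
    have "r * q - s * p \<in> {1, -1}" using less.prems by (auto simp: algebra_simps)
    then show ?thesis
      using diagonal [where a = r and b = s and c = p and d = q] 4 less.prems swap [of 1 0 0 1] one by auto
  qed
qed

lemma pgl_mult:
  "pgl a b c d \<otimes>\<^bsub>PGL2Z\<^esub> pgl a' b' c' d' =
   pgl (a * a' + b * c') (a * b' + b * d') (c * a' + d * c') (c * b' + d * d')"
  unfolding pgl_eq PGL2Z_def FactGroup_def set_mult_def
  by (auto simp: GL2Z_def uminus_mult mat2_mult)

lemma pgl_uminus: "pgl (- a) (- b) (- c) (- d) = pgl a b c d"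
  by (auto simp: pgl_eq uminus_mat2)

text \<open>With \<open>f x = (con x, con (1 / x))\<close>, this is the class of the matrix sending
  the column (1, 1) to \<open>f y\<close> and (2, 1) to \<open>f z\<close>. As (1, 1) is
  \<open>f 1\<close> and (2, 1) is \<open>f 2\<close>, the points 1 and 2 give the identity.\<close>

definition con_pgl :: "rat \<Rightarrow> rat \<Rightarrow> (int^2^2) set" where
  "con_pgl y z = pgl (con z - con y) (2 * con y - con z)
     (con (1 / z) - con (1 / y)) (2 * con (1 / y) - con (1 / z))"

lemma con_pgl_1_2: "con_pgl 1 2 = pgl 1 0 0 1"
  using con_1_plus [of 1] con_inverse_1_plus [of 1] by (simp add: con_pgl_def)

lemma con_pgl_inverse: "con_pgl (1 / y) (1 / z) = pgl_U \<otimes>\<^bsub>PGL2Z\<^esub> con_pgl y z"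
  by (simp add: con_pgl_def pgl_U_def pgl_mult)

lemma con_pgl_1_plus:
  assumes "y > 0" "z > 0"
  shows "con_pgl (1 + y) (1 + z) = pgl 1 1 1 0 \<otimes>\<^bsub>PGL2Z\<^esub> con_pgl y z"
  using assms by (simp add: con_pgl_def pgl_mult con_1_plus con_inverse_1_plus algebra_simps)

locale Dyer_automorphism =
  fixes \<alpha> :: "(int^2^2) set \<Rightarrow> (int^2^2) set"
  assumes Dyer: "is_Dyer_automorphism \<alpha>"
begin

lemma image_mult:
  assumes "X \<in> carrier PGL2Z" "Y \<in> carrier PGL2Z"
  shows "\<alpha> (X \<otimes>\<^bsub>PGL2Z\<^esub> Y) = \<alpha> X \<otimes>\<^bsub>PGL2Z\<^esub> \<alpha> Y"
  using Dyer assms by (auto simp: is_Dyer_automorphism_def iso_def hom_def)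

lemma image_one: "\<alpha> (pgl 1 0 0 1) = pgl 1 0 0 1"
proof -
  have "pgl 1 0 0 1 = pgl_U \<otimes>\<^bsub>PGL2Z\<^esub> pgl_U" by (simp add: pgl_U_def pgl_mult)
  moreover have "pgl_U \<in> carrier PGL2Z" by (simp add: pgl_U_def pgl_in_PGL2Z_iff)
  ultimately show ?thesis using Dyer image_mult by (simp add: is_Dyer_automorphism_def)
qed

lemma image_translation: "\<alpha> (pgl 1 1 0 1) = pgl 1 1 1 0"
proof -
  have "pgl 1 1 0 1 = pgl_K \<otimes>\<^bsub>PGL2Z\<^esub> pgl_V" by (simp add: pgl_K_def pgl_V_def pgl_mult)
  moreover have "pgl_K \<in> carrier PGL2Z" "pgl_V \<in> carrier PGL2Z"
    by (simp_all add: pgl_K_def pgl_V_def pgl_in_PGL2Z_iff)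
  ultimately have "\<alpha> (pgl 1 1 0 1) = pgl_K \<otimes>\<^bsub>PGL2Z\<^esub> (pgl_U \<otimes>\<^bsub>PGL2Z\<^esub> pgl_V)"
    using Dyer image_mult by (simp add: is_Dyer_automorphism_def)
  \<comment> \<open>The product comes out as the negative of the target matrix, the same class
    modulo sign.\<close>
  then show ?thesis by (simp add: pgl_K_def pgl_V_def pgl_U_def pgl_mult pgl_uminus [of 1 1 1 0, simplified])
qed

text \<open>Zero entries are allowed so that the induction can start at the identity.\<close>

lemma eq_con_pgl:
  assumes "p \<ge> 0" "q \<ge> 0" "r \<ge> 0" "s \<ge> 0" "p * s - q * r \<in> {1, -1}"
  shows "\<alpha> (pgl p q r s) =
    con_pgl (of_int (p + q) / of_int (r + s)) (of_int (2 * p + q) / of_int (2 * r + s))"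
  using assms
proof (induction rule: nonneg_unimodular_induct)
  case one
  then show ?case by (simp add: image_one con_pgl_1_2)
next
  case (swap p q r s)
  have "pgl r s p q = pgl_U \<otimes>\<^bsub>PGL2Z\<^esub> pgl p q r s" by (simp add: pgl_U_def pgl_mult)
  moreover have "pgl_U \<in> carrier PGL2Z" by (simp add: pgl_U_def pgl_in_PGL2Z_iff)
  moreover have "pgl p q r s \<in> carrier PGL2Z" using swap by (simp only: pgl_in_PGL2Z_iff)
  ultimately have "\<alpha> (pgl r s p q) = pgl_U \<otimes>\<^bsub>PGL2Z\<^esub> \<alpha> (pgl p q r s)"
    using Dyer image_mult by (simp add: is_Dyer_automorphism_def)
  then show ?case unfolding swap.IH con_pgl_inverse [symmetric] by simp
next
  case (add p q r s)
  \<comment> \<open>No row vanishes, so \<open>y\<close> and \<open>z\<close> are positive and the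
    functional equations of \<open>con\<close> apply.\<close>
  have "p + q > 0" "r + s > 0"
    using add by (cases "p = 0"; cases "q = 0"; cases "r = 0"; cases "s = 0"; auto)+
  then have pos: "p + q > 0" "r + s > 0" "2 * p + q > 0" "2 * r + s > 0" using add by auto
  define y z :: rat where "y = of_int (p + q) / of_int (r + s)"
    and "z = of_int (2 * p + q) / of_int (2 * r + s)"
  have yz: "y > 0" "z > 0"
    unfolding y_def z_def using pos by (simp_all only: divide_pos_pos of_int_0_less_iff)
  have nz: "(of_int (r + s) :: rat) \<noteq> 0" "(of_int (2 * r + s) :: rat) \<noteq> 0"
    using pos by (simp_all only: of_int_eq_0_iff)
  \<comment> \<open>Adding the second row to the first translates the images of 1 and 2 by
    1.\<close>
  have "of_int (p + r + (q + s)) / of_int (r + s) = 1 + y"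
    "of_int (2 * (p + r) + (q + s)) / of_int (2 * r + s) = 1 + z"
    using nz by (simp_all add: y_def z_def divide_simps)
  moreover have "pgl (p + r) (q + s) r s = pgl 1 1 0 1 \<otimes>\<^bsub>PGL2Z\<^esub> pgl p q r s"
    by (simp add: pgl_mult)
  moreover have "pgl 1 1 0 1 \<in> carrier PGL2Z" by (simp add: pgl_in_PGL2Z_iff)
  moreover have "pgl p q r s \<in> carrier PGL2Z" using add by (simp only: pgl_in_PGL2Z_iff)
  ultimately show ?case
    using add.IH image_mult image_translation con_pgl_1_plus [OF yz] by (simp add: y_def z_def)
qed

end

theorem lemma5:
  fixes \<alpha> :: "(int^2^2) set \<Rightarrow> (int^2^2) set" and p q r s :: int
  assumes "is_Dyer_automorphism \<alpha>"
    and "p > 0" "q > 0" "r > 0" "s > 0"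
    and "pgl p q r s \<in> carrier PGL2Z"
  shows "\<alpha> (pgl p q r s) =
    pgl (con (of_int (2 * p + q) / of_int (2 * r + s)) - con (of_int (p + q) / of_int (r + s)))
        (2 * con (of_int (p + q) / of_int (r + s)) - con (of_int (2 * p + q) / of_int (2 * r + s)))
        (con (of_int (2 * r + s) / of_int (2 * p + q)) - con (of_int (r + s) / of_int (p + q)))
        (2 * con (of_int (r + s) / of_int (p + q)) - con (of_int (2 * r + s) / of_int (2 * p + q)))"
proof -
  interpret Dyer_automorphism \<alpha> by unfold_locales (fact assms(1))
  show ?thesis
    using eq_con_pgl [of p q r s] assms(2-6) by (simp add: pgl_in_PGL2Z_iff con_pgl_def)
qed

end
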